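(* Let $\mathcal{H}$ be a complex Hilbert space, $\mathcal{D}$ a dense subspace of $\mathcal{H}$ and $\Omega$ a sesquilinear form on $\mathcal{D}$ which is q-closed with respect to a norm $\|\cdot\|_\Omega$ on $\mathcal{D}$. Then the adjoint form $\Omega^*$ is also q-closed with respect to $\|\cdot\|_\Omega$. Moreover, $\Upsilon\in\mathfrak{P}(\Omega)$ if and only if $\Upsilon^*\in\mathfrak{P}(\Omega^* )$, and if $\Omega$ is solvable with respect to $\|\cdot\|_\Omega$ with associated operator $T$, then $\Omega^*$ is solvable with respect to $\|\cdot\|_\Omega$ with associated operator $T^*$.
   Context: Let $\langle\cdot|\cdot\rangle$ and $\|\cdot\|$ be the inner product and norm of $\mathcal{H}$. Sesquilinear forms are linear in the first variable and conjugate linear in the second. The adjoint of a form $\Omega$ on $\mathcal{D}$ is $\Omega^*(\xi,\eta)=\overline{\Omega(\eta,\xi)}$, $\xi,\eta\in\mathcal{D}$ (similarly for forms $\Upsilon$ on $\mathcal{H}$). A sesquilinear form $\Omega$ on the dense subspace $\mathcal{D}$ is q-closed with respect to a norm $\|\cdot\|_\Omega$ on $\mathcal{D}$ if: (1) there is $\alpha>0$ with $\|\xi\|\le\alpha\|\xi\|_\Omega$ for all $\xi\in\mathcal{D}$; (2) if $\{\xi_n\}\subset\mathcal{D}$, $\|\xi_n\|\to0$ and $\|\xi_n-\xi_m\|_\Omega\to0$, then $\|\xi_n\|_\Omega\to0$; (3) $\mathcal{E}_\Omega:=\mathcal{D}[\|\cdot\|_\Omega]$ is a reflexive Banach space; (4)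 there is $\beta>0$ with $|\Omega(\xi,\eta)|\le\beta\|\xi\|_\Omega\|\eta\|_\Omega$ for all $\xi,\eta\in\mathcal{D}$. Let $\mathcal{E}_\Omega^\times$ be the conjugate dual of $\mathcal{E}_\Omega$ (bounded conjugate linear functionals). For $\Omega$ q-closed with respect to $\|\cdot\|_\Omega$, $\mathfrak{P}(\Omega)$ is the set of bounded sesquilinear forms $\Upsilon$ on $\mathcal{H}$ such that (i) if $\xi\in\mathcal{D}$ and $(\Omega+\Upsilon)(\xi,\eta)=0$ for all $\eta\in\mathcal{D}$, then $\xi=0$; (ii) for every $\Lambda\in\mathcal{E}_\Omega^\times$ there is $\xi\in\mathcal{D}$ with $\Lambda(\eta)=(\Omega+\Upsilon)(\xi,\eta)$ for all $\eta\in\mathcal{D}$. $\Omega$ is solvable with respect to $\|\cdot\|_\Omega$ if it is q-closed with respect to $\|\cdot\|_\Omega$ and $\mathfrak{P}(\Omega)\neq\varnothing$. The operator associated to a solvable form $\Omega$ is the (closed, densely defined) operator $T$ with $D(T)=\{\xi\in\mathcal{D}:\exists\,\chi\in\mathcal{H}\text{ with }\Omega(\xi,\eta)=\langle\chi|\eta\rangle\ \forall\eta\in\mathcal{D}\}$ and $T\xi=\chi$; it is the greatest operator $T$ with $D(T)\subseteq\mathcal{D}$ and $\Omega(\xi,\eta)=\langle T\xi|\eta\rangle$ for all $\xi\in D(T)$, $\eta\in\mathcal{D}$. $T^*$ is the Hilbert space adjoint of $T$. *)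

theory Defs
  imports "HOL-Analysis.Analysis" "HOL-Library.Function_Algebras"
begin

section \<open>Complex vector spaces and complex Hilbert spaces\<close>

class scaleC =
  fixes scaleC :: "complex \<Rightarrow> 'a \<Rightarrow> 'a" (infixr "*\<^sub>C" 75)

class complex_vector = scaleC + ab_group_add +
  assumes scaleC_add_right: "a *\<^sub>C (x + y) = a *\<^sub>C x + a *\<^sub>C y"
    and scaleC_add_left: "(a + b) *\<^sub>C x = a *\<^sub>C x + b *\<^sub>C x"
    and scaleC_scaleC: "a *\<^sub>C (b *\<^sub>C x) = (a * b) *\<^sub>C x"
    and scaleC_one: "1 *\<^sub>C x = x"

global_interpretation complex_vector: vector_space "scaleC :: complex \<Rightarrow> 'a \<Rightarrow> 'a::complex_vector"
  by unfold_locales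
    (simp_all add: scaleC_add_right scaleC_add_left scaleC_scaleC scaleC_one)

instantiation complex :: complex_vector
begin
definition scaleC_complex :: "complex \<Rightarrow> complex \<Rightarrow> complex"
  where "scaleC_complex c z = c * z"
instance
  by standard (simp_all add: scaleC_complex_def algebra_simps)
end

instantiation "fun" :: (type, complex_vector) complex_vector
begin
definition scaleC_fun :: "complex \<Rightarrow> ('a \<Rightarrow> 'b) \<Rightarrow> 'a \<Rightarrow> 'b"
  where "scaleC_fun c f = (\<lambda>x. c *\<^sub>C f x)"
instance
  by standard (simp_all add: fun_eq_iff scaleC_fun_def scaleC_add_right scaleC_add_left
      scaleC_scaleC scaleC_one)
end

text \<open>The inner product is linear in the first and conjugate linear in the second variable.\<close>

class complex_hilbert_space = complex_vector + banach +
  fixes cinner :: "'a \<Rightarrow> 'a \<Rightarrow> complex"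
  assumes scaleR_scaleC: "r *\<^sub>R x = complex_of_real r *\<^sub>C x"
    and cinner_commute: "cinner x y = cnj (cinner y x)"
    and cinner_add_left: "cinner (x + y) z = cinner x z + cinner y z"
    and cinner_scaleC_left: "cinner (c *\<^sub>C x) y = c * cinner x y"
    and cinner_ge_zero: "0 \<le> Re (cinner x x)"
    and cinner_eq_zero_iff: "cinner x x = 0 \<longleftrightarrow> x = 0"
    and norm_eq_sqrt_cinner: "norm x = sqrt (Re (cinner x x))"

instantiation complex :: complex_hilbert_space
begin
definition cinner_complex :: "complex \<Rightarrow> complex \<Rightarrow> complex"
  where "cinner_complex x y = x * cnj y"
instance
proof
  show "0 \<le> Re (cinner x x)" for x :: complex
    by (simp add: cinner_complex_def)
  show "norm x = sqrt (Re (cinner x x))" for x :: complex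
    by (simp add: cinner_complex_def cmod_def power2_eq_square)
qed (simp_all add: cinner_complex_def scaleC_complex_def algebra_simps scaleR_conv_of_real)
end


section \<open>Norms on subspaces, dual spaces, reflexivity\<close>

definition norm_on :: "'v::complex_vector set \<Rightarrow> ('v \<Rightarrow> real) \<Rightarrow> bool" where
  "norm_on V N \<longleftrightarrow>
     (\<forall>x\<in>V. 0 \<le> N x) \<and>
     (\<forall>x\<in>V. N x = 0 \<longleftrightarrow> x = 0) \<and>
     (\<forall>c. \<forall>x\<in>V. N (c *\<^sub>C x) = cmod c * N x) \<and>
     (\<forall>x\<in>V. \<forall>y\<in>V. N (x + y) \<le> N x + N y)"

definition Cauchy_wrt :: "('v::complex_vector \<Rightarrow> real) \<Rightarrow> (nat \<Rightarrow> 'v) \<Rightarrow> bool" where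
  "Cauchy_wrt N X \<longleftrightarrow> (\<forall>e>0. \<exists>M. \<forall>m\<ge>M. \<forall>n\<ge>M. N (X m - X n) < e)"

definition complete_wrt :: "'v::complex_vector set \<Rightarrow> ('v \<Rightarrow> real) \<Rightarrow> bool" where
  "complete_wrt V N \<longleftrightarrow>
     (\<forall>X. (\<forall>n. X n \<in> V) \<longrightarrow> Cauchy_wrt N X \<longrightarrow> (\<exists>x\<in>V. (\<lambda>n. N (X n - x)) \<longlonglongrightarrow> 0))"

text \<open>Functionals on a subspace \<open>V\<close> are represented by functions vanishing outside \<open>V\<close>, so that
  equality of functions is equality of functionals and the dual is itself a linear subspace
  (of the function space), to which the construction can be applied again.\<close>

definition dual_space :: "'v::complex_vector set \<Rightarrow> ('v \<Rightarrow> real) \<Rightarrow> ('v \<Rightarrow> complex) set" where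
  "dual_space V N = {f.
     (\<forall>x\<in>V. \<forall>y\<in>V. f (x + y) = f x + f y) \<and>
     (\<forall>c. \<forall>x\<in>V. f (c *\<^sub>C x) = c * f x) \<and>
     (\<exists>B. \<forall>x\<in>V. cmod (f x) \<le> B * N x) \<and>
     (\<forall>x. x \<notin> V \<longrightarrow> f x = 0)}"

definition conj_dual_space :: "'v::complex_vector set \<Rightarrow> ('v \<Rightarrow> real) \<Rightarrow> ('v \<Rightarrow> complex) set" where
  "conj_dual_space V N = {f.
     (\<forall>x\<in>V. \<forall>y\<in>V. f (x + y) = f x + f y) \<and>
     (\<forall>c. \<forall>x\<in>V. f (c *\<^sub>C x) = cnj c * f x) \<and>
     (\<exists>B. \<forall>x\<in>V. cmod (f x) \<le> B * N x) \<and>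
     (\<forall>x. x \<notin> V \<longrightarrow> f x = 0)}"

definition dual_norm :: "'v set \<Rightarrow> ('v \<Rightarrow> real) \<Rightarrow> ('v \<Rightarrow> complex) \<Rightarrow> real" where
  "dual_norm V N f = (SUP x\<in>{x\<in>V. N x \<le> 1}. cmod (f x))"

text \<open>The canonical embedding into the bidual is onto.\<close>

definition reflexive_wrt :: "'v::complex_vector set \<Rightarrow> ('v \<Rightarrow> real) \<Rightarrow> bool" where
  "reflexive_wrt V N \<longleftrightarrow>
     (\<forall>\<Phi>\<in>dual_space (dual_space V N) (dual_norm V N).
        \<exists>x\<in>V. \<forall>f\<in>dual_space V N. \<Phi> f = f x)"


section \<open>Sesquilinear forms\<close>

text \<open>A form on \<open>D\<close> is a function on the whole type of which only the values on \<open>D \<times> D\<close> matter.\<close>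

definition sesquilinear_on ::
    "'v::complex_vector set \<Rightarrow> ('v \<Rightarrow> 'v \<Rightarrow> complex) \<Rightarrow> bool" where
  "sesquilinear_on D \<Omega> \<longleftrightarrow>
     (\<forall>x\<in>D. \<forall>y\<in>D. \<forall>z\<in>D. \<Omega> (x + y) z = \<Omega> x z + \<Omega> y z) \<and>
     (\<forall>c. \<forall>x\<in>D. \<forall>z\<in>D. \<Omega> (c *\<^sub>C x) z = c * \<Omega> x z) \<and>
     (\<forall>x\<in>D. \<forall>y\<in>D. \<forall>z\<in>D. \<Omega> z (x + y) = \<Omega> z x + \<Omega> z y) \<and>
     (\<forall>c. \<forall>x\<in>D. \<forall>z\<in>D. \<Omega> z (c *\<^sub>C x) = cnj c * \<Omega> z x)"

definition form_adjoint :: "('v \<Rightarrow> 'v \<Rightarrow> complex) \<Rightarrow> 'v \<Rightarrow> 'v \<Rightarrow> complex" where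
  "form_adjoint \<Omega> = (\<lambda>\<xi> \<eta>. cnj (\<Omega> \<eta> \<xi>))"

definition bounded_sesquilinear ::
    "('a::complex_hilbert_space \<Rightarrow> 'a \<Rightarrow> complex) \<Rightarrow> bool" where
  "bounded_sesquilinear \<Upsilon> \<longleftrightarrow>
     sesquilinear_on UNIV \<Upsilon> \<and> (\<exists>B. \<forall>\<xi> \<eta>. cmod (\<Upsilon> \<xi> \<eta>) \<le> B * norm \<xi> * norm \<eta>)"

definition q_closed ::
    "'a::complex_hilbert_space set \<Rightarrow> ('a \<Rightarrow> real) \<Rightarrow> ('a \<Rightarrow> 'a \<Rightarrow> complex) \<Rightarrow> bool" where
  "q_closed D N \<Omega> \<longleftrightarrow>
     sesquilinear_on D \<Omega> \<and> norm_on D N \<and>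
     (\<exists>\<alpha>>0. \<forall>\<xi>\<in>D. norm \<xi> \<le> \<alpha> * N \<xi>) \<and>
     (\<forall>X. (\<forall>n. X n \<in> D) \<longrightarrow> (\<lambda>n. norm (X n)) \<longlonglongrightarrow> 0 \<longrightarrow> Cauchy_wrt N X
          \<longrightarrow> (\<lambda>n. N (X n)) \<longlonglongrightarrow> 0) \<and>
     complete_wrt D N \<and> reflexive_wrt D N \<and>
     (\<exists>\<beta>>0. \<forall>\<xi>\<in>D. \<forall>\<eta>\<in>D. cmod (\<Omega> \<xi> \<eta>) \<le> \<beta> * N \<xi> * N \<eta>)"

text \<open>The set \<open>\<PP>(\<Omega>)\<close>.\<close>

definition form_perturbations ::
    "'a::complex_hilbert_space set \<Rightarrow> ('a \<Rightarrow> real) \<Rightarrow> ('a \<Rightarrow> 'a \<Rightarrow> complex)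
      \<Rightarrow> ('a \<Rightarrow> 'a \<Rightarrow> complex) set" where
  "form_perturbations D N \<Omega> = {\<Upsilon>. bounded_sesquilinear \<Upsilon> \<and>
     (\<forall>\<xi>\<in>D. (\<forall>\<eta>\<in>D. \<Omega> \<xi> \<eta> + \<Upsilon> \<xi> \<eta> = 0) \<longrightarrow> \<xi> = 0) \<and>
     (\<forall>\<Lambda>\<in>conj_dual_space D N. \<exists>\<xi>\<in>D. \<forall>\<eta>\<in>D. \<Lambda> \<eta> = \<Omega> \<xi> \<eta> + \<Upsilon> \<xi> \<eta>)}"

definition solvable ::
    "'a::complex_hilbert_space set \<Rightarrow> ('a \<Rightarrow> real) \<Rightarrow> ('a \<Rightarrow> 'a \<Rightarrow> complex) \<Rightarrow> bool" where
  "solvable D N \<Omega> \<longleftrightarrow> q_closed D N \<Omega> \<and> form_perturbations D N \<Omega> \<noteq> {}"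


section \<open>Unbounded operators\<close>

text \<open>Operators are identified with their graphs. The two relations below are single-valued when
  \<open>D\<close>, respectively the domain of \<open>T\<close>, is dense (see the lemmas). Conversely, for a linear \<open>T\<close>
  the relation \<open>operator_adjoint T\<close> is single-valued only if the domain of \<open>T\<close> is dense;
  equating it with an operator therefore includes that \<open>T\<close> is densely defined.\<close>

definition associated_operator ::
    "'a::complex_hilbert_space set \<Rightarrow> ('a \<Rightarrow> 'a \<Rightarrow> complex) \<Rightarrow> ('a \<times> 'a) set" where
  "associated_operator D \<Omega> = {(\<xi>, \<phi>). \<xi> \<in> D \<and> (\<forall>\<eta>\<in>D. \<Omega> \<xi> \<eta> = cinner \<phi> \<eta>)}"

definition operator_adjoint :: "('a::complex_hilbert_space \<times> 'a) set \<Rightarrow> ('a \<times> 'a) set" where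
  "operator_adjoint T = {(\<eta>, \<zeta>). \<forall>(\<xi>, \<phi>)\<in>T. cinner \<phi> \<eta> = cinner \<xi> \<zeta>}"

lemma cinner_dense_eqI:
  fixes x y :: "'a::complex_hilbert_space"
  assumes D: "closure D = UNIV" and eq: "\<And>\<eta>. \<eta> \<in> D \<Longrightarrow> cinner x \<eta> = cinner y \<eta>"
  shows "x = y"
proof -
  define d where "d = x - y"
  have minus: "cinner (- u) v = - cinner u v" for u v :: 'a
    using cinner_scaleC_left[of "-1" u v] by simp
  have diff: "cinner (u - w) v = cinner u v - cinner w v" for u v w :: 'a
    using cinner_add_left[of u "- w" v] by (simp add: minus)
  have orth: "cinner d \<eta> = 0" if "\<eta> \<in> D" for \<eta>
    using eq[OF that] by (simp add: d_def diff)
  have le: "norm d \<le> norm (d - \<eta>)" if "\<eta> \<in> D" for \<eta>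
  proof -
    have *: "cinner \<eta> d = 0"
      using orth[OF that] cinner_commute[of \<eta> d] by simp
    have "cinner (d - \<eta>) (d - \<eta>) = cinner d (d - \<eta>) - cinner \<eta> (d - \<eta>)"
      by (rule diff)
    also have "cinner d (d - \<eta>) = cinner d d"
      using cinner_commute[of d "d - \<eta>"] cinner_commute[of d d] by (simp add: diff *)
    also have "cinner \<eta> (d - \<eta>) = - cinner \<eta> \<eta>"
      using cinner_commute[of \<eta> "d - \<eta>"] cinner_commute[of \<eta> \<eta>] orth[OF that]
      by (simp add: diff)
    finally show ?thesis
      using cinner_ge_zero[of \<eta>] by (simp add: norm_eq_sqrt_cinner)
  qed
  have "norm d < e" if "e > 0" for e
  proof -
    have "d \<in> closure D" by (simp add: D)
    then obtain \<eta> where "\<eta> \<in> D" "dist \<eta> d < e"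
      using \<open>e > 0\<close> unfolding closure_approachable by blast
    then show ?thesis
      using le[of \<eta>] by (simp add: dist_norm norm_minus_commute)
  qed
  then have "norm d = 0"
    by (metis less_irrefl norm_ge_zero order_le_less)
  then show ?thesis by (simp add: d_def)
qed

lemma single_valued_associated_operator:
  assumes "closure D = UNIV"
  shows "single_valued (associated_operator D \<Omega>)"
  by (rule single_valuedI)
    (auto simp: associated_operator_def intro!: cinner_dense_eqI[OF assms])

lemma single_valued_operator_adjoint:
  assumes "closure (Domain T) = UNIV"
  shows "single_valued (operator_adjoint T)"
proof (rule single_valuedI)
  fix \<eta> \<zeta> \<zeta>'
  assume a: "(\<eta>, \<zeta>) \<in> operator_adjoint T" "(\<eta>, \<zeta>') \<in> operator_adjoint T"
  show "\<zeta> = \<zeta>'"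
  proof (rule cinner_dense_eqI[OF assms])
    fix \<xi> assume "\<xi> \<in> Domain T"
    then obtain \<phi> where "(\<xi>, \<phi>) \<in> T" by blast
    with a have "cinner \<xi> \<zeta> = cinner \<xi> \<zeta>'"
      by (fastforce simp: operator_adjoint_def)
    then show "cinner \<zeta> \<xi> = cinner \<zeta>' \<xi>"
      by (metis cinner_commute)
  qed
qed

end

theory Submission
  imports Defs
begin

text \<open>Write \<open>B = \<Omega> + \<Upsilon>\<close> with \<open>\<Upsilon> \<in> \<PP>(\<Omega>)\<close>. The map \<open>x \<mapsto> B(x, \<sqdot>)\<close> is a bounded bijection from
  \<open>D[N]\<close> onto its conjugate dual, hence the dual norm of \<open>B(x, \<sqdot>)\<close> is a complete norm on \<open>D\<close>
  dominated by \<open>N\<close>, and by Baire's theorem it dominates \<open>N\<close>. So the inverse map is bounded, and its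
  transpose together with reflexivity gives surjectivity for the adjoint form; injectivity follows by
  representing the functional \<open>\<langle>\<xi>|\<sqdot>\<rangle>\<close>. For the operators, given \<open>T\<^sup>* \<eta> = \<zeta>\<close>, represent
  \<open>\<langle>\<zeta>|\<sqdot>\<rangle> + \<Upsilon>\<^sup>*(\<eta>, \<sqdot>)\<close> as \<open>(\<Omega>\<^sup>* + \<Upsilon>\<^sup>*)(\<eta>', \<sqdot>)\<close> with \<open>\<eta>' \<in> D\<close>; then \<open>\<eta> - \<eta>'\<close> is orthogonal to the
  range of \<open>T + U\<close>, \<open>U\<close> being the bounded operator of \<open>\<Upsilon>\<close>, which is the whole space.\<close>

section \<open>Comparable complete norms\<close>

locale normed_subspace =
  fixes V :: "'v::complex_vector set" and N :: "'v \<Rightarrow> real"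
  assumes subspace: "complex_vector.subspace V" and norm: "norm_on V N"
begin

lemma closed_ops [simp]:
  "0 \<in> V" "x \<in> V \<Longrightarrow> y \<in> V \<Longrightarrow> x + y \<in> V" "x \<in> V \<Longrightarrow> y \<in> V \<Longrightarrow> x - y \<in> V"
  "x \<in> V \<Longrightarrow> c *\<^sub>C x \<in> V"
  using subspace complex_vector.subspace_diff
  by (auto simp: complex_vector.subspace_def)

lemma nonneg [simp]: "x \<in> V \<Longrightarrow> 0 \<le> N x"
  and zero_iff: "x \<in> V \<Longrightarrow> N x = 0 \<longleftrightarrow> x = 0"
  and scale: "x \<in> V \<Longrightarrow> N (c *\<^sub>C x) = cmod c * N x"
  and triangle: "x \<in> V \<Longrightarrow> y \<in> V \<Longrightarrow> N (x + y) \<le> N x + N y"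
  using norm by (auto simp: norm_on_def)

lemma zero [simp]: "N 0 = 0"
  using zero_iff[of 0] by simp

lemma minus_commute: "x \<in> V \<Longrightarrow> y \<in> V \<Longrightarrow> N (x - y) = N (y - x)"
  using scale[of "x - y" "-1"] by simp

lemma triangle_diff: "x \<in> V \<Longrightarrow> y \<in> V \<Longrightarrow> N (x - y) \<le> N x + N y"
  using triangle[of x "-1 *\<^sub>C y"] scale[of y "-1"] closed_ops(4)[of y "-1"] by simp

lemma dist_triangle: "x \<in> V \<Longrightarrow> y \<in> V \<Longrightarrow> z \<in> V \<Longrightarrow> N (x - z) \<le> N (x - y) + N (y - z)"
  using triangle[of "x - y" "y - z"] by simp

text \<open>\<open>Metric_space\<close> asks for symmetry and nonnegativity on the whole type,
  whereas \<open>N\<close> is constrained only on \<open>V\<close>; hence the value 0 off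
  \<open>V\<close>.\<close>

definition dist_fun :: "'v \<Rightarrow> 'v \<Rightarrow> real"
  where "dist_fun x y = (if x \<in> V \<and> y \<in> V then N (x - y) else 0)"

lemma Metric_space_dist_fun: "Metric_space V dist_fun"
  by standard (auto simp: dist_fun_def minus_commute zero_iff intro: dist_triangle)

lemma mcomplete_dist_fun:
  assumes "complete_wrt V N"
  shows "Metric_space.mcomplete V dist_fun"
proof -
  interpret Metric_space V dist_fun by (rule Metric_space_dist_fun)
  show ?thesis
    unfolding mcomplete_def
  proof (intro allI impI)
    fix X assume X: "MCauchy X"
    then have V: "X n \<in> V" for n by (auto simp: MCauchy_def)
    have "Cauchy_wrt N X"
      using X V by (auto simp: Cauchy_wrt_def MCauchy_def dist_fun_def)
    with assms V obtain x where x: "x \<in> V" "(\<lambda>n. N (X n - x)) \<longlonglongrightarrow> 0"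
      unfolding complete_wrt_def by blast
    have "(\<lambda>n. dist_fun (X n) x) = (\<lambda>n. N (X n - x))"
      using V x by (simp add: dist_fun_def)
    then show "\<exists>x. limitin mtopology X x sequentially"
      using x V by (intro exI[of _ x]) (simp add: limitin_metric_dist_null)
  qed
qed

end

text \<open>Subtracting approximants repeatedly expresses \<open>x\<close> as an \<open>N\<close>-convergent series.\<close>

lemma norm_le_of_approximation:
  fixes V :: "'v::complex_vector set"
  assumes "normed_subspace V N" "normed_subspace V M"
    and complete: "complete_wrt V N"
    and le: "\<And>x. x \<in> V \<Longrightarrow> M x \<le> C * N x"
    and "0 \<le> K"
    and approx: "\<And>x. x \<in> V \<Longrightarrow> \<exists>u\<in>V. N u \<le> K * M x \<and> M (x - u) \<le> M x / 2"
    and x: "x \<in> V"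
  shows "N x \<le> 2 * K * M x"
proof -
  interpret N: normed_subspace V N by fact
  interpret M: normed_subspace V M by fact
  obtain g where g: "\<And>x. x \<in> V \<Longrightarrow> g x \<in> V \<and> N (g x) \<le> K * M x \<and> M (x - g x) \<le> M x / 2"
    using approx by metis
  \<comment> \<open>\<open>r n\<close> is the remainder after \<open>n\<close> corrections by
    \<open>g\<close>, and \<open>s n\<close> the sum of those corrections.\<close>
  define r where "r n = ((\<lambda>x. x - g x) ^^ n) x" for n
  define s where "s n = x - r n" for n
  have r_Suc: "r (Suc n) = r n - g (r n)" and r0: "r 0 = x" for n
    by (simp_all add: r_def)
  have rV: "r n \<in> V" for n
    by (induction n) (use x g in \<open>auto simp: r_Suc r0\<close>)
  have sV: "s n \<in> V" for n
    using x rV by (simp add: s_def)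
  have M_r: "M (r n) \<le> M x / 2 ^ n" for n
  proof (induction n)
    case (Suc n)
    then show ?case
      using g[OF rV[of n]] by (simp add: r_Suc)
  qed (simp add: r0)
  \<comment> \<open>The value of the geometric series with terms \<open>K * M x / 2 ^ n\<close>,
    which bound the \<open>N\<close>-norms of the corrections.\<close>
  define c where "c = 2 * K * M x"
  have c: "0 \<le> c" using x \<open>0 \<le> K\<close> by (simp add: c_def)
  have step: "N (s (Suc n) - s n) \<le> c / 2 / 2 ^ n" for n
  proof -
    have "N (s (Suc n) - s n) \<le> K * M (r n)"
      using g[OF rV[of n]] by (simp add: s_def r_Suc)
    also have "\<dots> \<le> K * (M x / 2 ^ n)"
      by (rule mult_left_mono[OF M_r \<open>0 \<le> K\<close>])
    finally show ?thesis by (simp add: c_def)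
  qed
  \<comment> \<open>The geometric bounds telescope; keeping the subtracted term makes the induction
    close.\<close>
  have tail: "N (s (m + k) - s m) \<le> c / 2 ^ m - c / 2 ^ (m + k)" for m k
  proof (induction k)
    case (Suc k)
    have "N (s (m + Suc k) - s m) \<le> N (s (Suc (m + k)) - s (m + k)) + N (s (m + k) - s m)"
      using N.dist_triangle[OF sV sV sV] by simp
    also have "\<dots> \<le> c / 2 / 2 ^ (m + k) + (c / 2 ^ m - c / 2 ^ (m + k))"
      using step[of "m + k"] Suc.IH by (rule add_mono)
    also have "\<dots> = c / 2 ^ m - c / 2 ^ (m + Suc k)"
      by (simp add: field_simps)
    finally show ?case .
  qed simp
  have tail': "N (s (m + k) - s m) \<le> c / 2 ^ m" for m k
    using tail[of m k] c by (smt (verit) divide_nonneg_nonneg zero_le_power)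
  have to0: "(\<lambda>n. a / 2 ^ n) \<longlonglongrightarrow> 0" for a :: real
    using tendsto_mult_right_zero[OF LIMSEQ_inverse_realpow_zero[of 2], of a]
    by (simp add: divide_inverse)
  have "Cauchy_wrt N s"
    unfolding Cauchy_wrt_def
  proof (intro allI impI)
    fix e :: real assume "0 < e"
    then have "\<forall>\<^sub>F n in sequentially. c / 2 ^ n < e"
      by (rule order_tendstoD(2)[OF to0])
    then obtain n0 where n0: "\<And>n. n \<ge> n0 \<Longrightarrow> c / 2 ^ n < e"
      by (auto simp: eventually_sequentially)
    have *: "N (s m - s n) < e" if "n0 \<le> n" "n \<le> m" for m n
      using tail'[of n "m - n"] n0[OF that(1)] that(2) by simp
    have "N (s m - s n) < e" if "n0 \<le> n" "n0 \<le> m" for m n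
      using *[of n m] *[of m n] that N.minus_commute[OF sV[of m] sV[of n]]
      by (cases "n \<le> m") auto
    then show "\<exists>M. \<forall>m\<ge>M. \<forall>n\<ge>M. N (s m - s n) < e" by blast
  qed
  with complete sV obtain l where l: "l \<in> V" "(\<lambda>n. N (s n - l)) \<longlonglongrightarrow> 0"
    unfolding complete_wrt_def by blast
  \<comment> \<open>The \<open>N\<close>-limit \<open>l\<close> is also the \<open>M\<close>-limit
    of \<open>s\<close>, as \<open>M\<close> is dominated by \<open>N\<close>; but
    \<open>s n\<close> tends to \<open>x\<close> in \<open>M\<close>, so
    \<open>x = l\<close>.\<close>
  have "M (x - l) \<le> M x / 2 ^ n + C * N (s n - l)" for n
  proof -
    have "M (x - l) \<le> M (x - s n) + M (s n - l)"
      by (rule M.dist_triangle[OF x sV l(1)])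
    then show ?thesis
      using M_r[of n] le[of "s n - l"] sV[of n] l(1) by (simp add: s_def)
  qed
  moreover have "(\<lambda>n. M x / 2 ^ n + C * N (s n - l)) \<longlonglongrightarrow> 0"
    using tendsto_add[OF to0[of "M x"] tendsto_mult_right_zero[OF l(2), of C]] by simp
  ultimately have "M (x - l) \<le> 0"
    by (intro LIMSEQ_le_const) auto
  then have "M (x - l) = 0"
    using M.nonneg[of "x - l"] x l(1) by (simp del: M.nonneg)
  then have "x = l"
    using M.zero_iff[of "x - l"] x l(1) by simp
  \<comment> \<open>Since \<open>s 0 = 0\<close>, the tail estimate from 0 bounds
    \<open>N (s n)\<close> by \<open>c\<close>.\<close>
  have "N x \<le> c + N (s n - l)" for n
  proof -
    have "N x \<le> N (s n) + N (x - s n)"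
      using N.triangle[of "s n" "x - s n"] sV x by simp
    then show ?thesis
      using tail'[of 0 n] N.minus_commute[OF x sV[of n]] by (simp add: s_def[of 0] r0 \<open>x = l\<close>)
  qed
  moreover have "(\<lambda>n. c + N (s n - l)) \<longlonglongrightarrow> c"
    using tendsto_add[OF tendsto_const l(2), of c] by simp
  ultimately show ?thesis
    unfolding c_def[symmetric] by (intro LIMSEQ_le_const) auto
qed

text \<open>An open mapping argument for the identity of \<open>V\<close>. Completeness under
  \<open>M\<close> lets Baire's theorem put an \<open>M\<close>-ball into the
  \<open>M\<close>-closure of some \<open>N\<close>-ball; translation to the origin and scaling give
  the approximations that \<open>norm_le_of_approximation\<close> sums up by completeness under
  \<open>N\<close>.\<close>

theorem comparable_complete_norms:
  fixes V :: "'v::complex_vector set"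
  assumes "normed_subspace V N" "normed_subspace V M"
    and "complete_wrt V N" "complete_wrt V M"
    and le: "\<And>x. x \<in> V \<Longrightarrow> M x \<le> C * N x"
  shows "\<exists>K. \<forall>x\<in>V. N x \<le> K * M x"
proof -
  interpret N: normed_subspace V N by fact
  interpret M: normed_subspace V M by fact
  interpret metric: Metric_space V M.dist_fun by (rule M.Metric_space_dist_fun)
  \<comment> \<open>\<open>A n\<close> is the \<open>M\<close>-closure in \<open>V\<close> of the
    \<open>N\<close>-ball of radius \<open>n\<close>; these sets exhaust \<open>V\<close>.\<close>
  define A where "A n = {x\<in>V. \<forall>e>0. \<exists>u\<in>V. N u \<le> real n \<and> M (x - u) < e}" for n :: nat
  have AV: "A n \<subseteq> V" for n by (auto simp: A_def)
  have closed: "closedin metric.mtopology (A n)" for n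
    unfolding metric.closedin_metric
  proof (intro conjI allI impI)
    fix x assume x: "x \<in> V - A n"
    then obtain e where e: "e > 0" "\<And>u. u \<in> V \<Longrightarrow> N u \<le> real n \<Longrightarrow> e \<le> M (x - u)"
      unfolding A_def by (auto simp: not_less)
    have "y \<notin> A n" if y: "y \<in> V" "M (x - y) < e / 2" for y
    proof
      assume "y \<in> A n"
      then obtain u where u: "u \<in> V" "N u \<le> real n" "M (y - u) < e / 2"
        using e(1) unfolding A_def by (auto dest!: spec[of _ "e / 2"])
      have "M (x - u) \<le> M (x - y) + M (y - u)"
        using x y u by (intro M.dist_triangle) auto
      then show False
        using e(2)[OF u(1,2)] y u by simp
    qed
    then show "\<exists>r>0. disjnt (A n) (metric.mball x r)"
      using e(1) x by (intro exI[of _ "e / 2"]) (auto simp: disjnt_iff M.dist_fun_def)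
  qed (rule AV)
  have "\<Union>(range A) = V"
  proof
    show "V \<subseteq> \<Union>(range A)"
    proof
      fix x assume x: "x \<in> V"
      obtain n where n: "N x \<le> real n" using real_arch_simple by blast
      have "x \<in> A n"
        unfolding A_def using x n by (auto intro!: bexI[of _ x])
      then show "x \<in> \<Union>(range A)" by blast
    qed
  qed (use AV in auto)
  moreover have "metric.mtopology interior_of V \<noteq> {}"
    using interior_of_topspace[of metric.mtopology] N.closed_ops(1)
    by (metis empty_iff metric.topspace_mtopology)
  ultimately have "\<exists>n. metric.mtopology interior_of (A n) \<noteq> {}"
    using metric.metric_Baire_category_alt[OF M.mcomplete_dist_fun[OF assms(4)], of "range A"] closed
    by auto
  then obtain n x0 r where r: "r > 0" and x0: "x0 \<in> V"
    and ball: "metric.mball x0 r \<subseteq> A n"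
    unfolding metric.metric_interior_of by auto
  have inA: "x0 + y \<in> A n" if "y \<in> V" "M y < r" for y
  proof -
    have "M.dist_fun x0 (x0 + y) = M y"
      using that x0 M.minus_commute[of x0 "x0 + y"] by (simp add: M.dist_fun_def)
    then show ?thesis
      using that x0 by (intro subsetD[OF ball]) simp
  qed
  \<comment> \<open>Subtracting approximants of \<open>x0 + y\<close> and of \<open>x0\<close> moves
    the ball to the origin and doubles the radius \<open>n\<close>.\<close>
  have near: "\<exists>u\<in>V. N u \<le> 2 * real n \<and> M (y - u) < e" if y: "y \<in> V" "M y < r" and "e > 0" for y e
  proof -
    obtain u where u: "u \<in> V" "N u \<le> real n" "M (x0 + y - u) < e / 2"
      using inA[OF y] \<open>e > 0\<close> unfolding A_def by (auto dest!: spec[of _ "e / 2"])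
    obtain v where v: "v \<in> V" "N v \<le> real n" "M (x0 - v) < e / 2"
      using inA[of 0] r \<open>e > 0\<close> unfolding A_def by (auto dest!: spec[of _ "e / 2"])
    have "M (y - (u - v)) \<le> M (x0 + y - u) + M (x0 - v)"
      using M.triangle_diff[of "x0 + y - u" "x0 - v"] x0 y u v by (simp add: algebra_simps)
    then show ?thesis
      using u v N.triangle_diff[OF u(1) v(1)] by (intro bexI[of _ "u - v"]) auto
  qed
  \<comment> \<open>Scaling \<open>x\<close> by \<open>t = r / (2 * M x)\<close> gives
    \<open>M\<close>-norm \<open>r / 2\<close>; undoing this turns \<open>2 * n\<close> into
    \<open>2 * n / t = (4 * n / r) * M x\<close>.\<close>
  define K where "K = 4 * real n / r"
  have "0 \<le> K" using r by (simp add: K_def)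
  have "\<exists>u\<in>V. N u \<le> K * M x \<and> M (x - u) \<le> M x / 2" if x: "x \<in> V" for x
  proof (cases "x = 0")
    case False
    then have Mx: "M x > 0" using M.nonneg[OF x] M.zero_iff[OF x] by simp
    define t where "t = r / (2 * M x)"
    have t: "t > 0" "t * M x < r" "t * M x = r / 2"
      using r Mx by (simp_all add: t_def)
    obtain u where u: "u \<in> V" "N u \<le> 2 * real n" "M (complex_of_real t *\<^sub>C x - u) < t * (M x / 2)"
      using near[of "complex_of_real t *\<^sub>C x" "t * (M x / 2)"] x t Mx by (auto simp: M.scale)
    define w where "w = complex_of_real (1 / t) *\<^sub>C u"
    have w: "w \<in> V" "N w = N u / t" using u t by (simp_all add: w_def N.scale norm_divide)
    have "complex_of_real t *\<^sub>C (x - w) = complex_of_real t *\<^sub>C x - u"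
      using t by (simp add: w_def complex_vector.scale_right_diff_distrib scaleC_scaleC scaleC_one)
    then have "t * M (x - w) < t * (M x / 2)"
      using M.scale[of "x - w" "complex_of_real t"] x w(1) u(3) t(1) by simp
    then have "M (x - w) \<le> M x / 2" using t(1) by simp
    moreover have "N w \<le> K * M x"
    proof -
      have "N w \<le> 2 * real n / t" using u(2) t(1) w(2) by (simp add: divide_right_mono)
      also have "\<dots> = K * M x" using r Mx by (simp add: t_def K_def)
      finally show ?thesis .
    qed
    ultimately show ?thesis using w by blast
  qed (auto intro: bexI[of _ 0])
  then have "N x \<le> 2 * K * M x" if "x \<in> V" for x
    using norm_le_of_approximation[OF assms(1,2,3) le \<open>0 \<le> K\<close>] that by blast
  then show ?thesis by blast
qed


section \<open>Forms inducing a bijection onto the conjugate dual\<close>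

context normed_subspace
begin

text \<open>A real supremum is informative only for a set bounded above. The hypothesis admits a
  negative \<open>b\<close> if \<open>V\<close> is trivial, whence the absolute value in the
  proof.\<close>

lemma bdd_above_dual_norm:
  assumes "\<And>x. x \<in> V \<Longrightarrow> cmod (f x) \<le> b * N x"
  shows "bdd_above ((\<lambda>x. cmod (f x)) ` {x\<in>V. N x \<le> 1})"
proof (rule bdd_aboveI2)
  fix x assume x: "x \<in> {x\<in>V. N x \<le> 1}"
  then have "cmod (f x) \<le> b * N x" using assms by blast
  also have "\<dots> \<le> \<bar>b\<bar> * N x" using x by (intro mult_right_mono) auto
  also have "\<dots> \<le> \<bar>b\<bar> * 1" using x by (intro mult_left_mono) auto
  finally show "cmod (f x) \<le> \<bar>b\<bar>" by simp
qed

lemma dual_norm_nonneg: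
  assumes "\<And>x. x \<in> V \<Longrightarrow> cmod (f x) \<le> b * N x"
  shows "0 \<le> dual_norm V N f"
  unfolding dual_norm_def
  by (rule cSUP_upper2[OF bdd_above_dual_norm[OF assms], of 0]) auto

text \<open>Normalise \<open>x\<close> to a unit vector. Homogeneity is asked of the modulus, which
  fits linear and conjugate linear functionals alike.\<close>

lemma norm_le_dual_norm:
  assumes bound: "\<And>x. x \<in> V \<Longrightarrow> cmod (f x) \<le> b * N x"
    and hom: "\<And>c x. x \<in> V \<Longrightarrow> cmod (f (c *\<^sub>C x)) = cmod c * cmod (f x)"
    and x: "x \<in> V"
  shows "cmod (f x) \<le> dual_norm V N f * N x"
proof (cases "N x = 0")
  case True
  then show ?thesis using bound[OF x] by simp
next
  case False
  then have pos: "N x > 0" using nonneg[OF x] by (simp del: nonneg)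
  define u where "u = complex_of_real (1 / N x) *\<^sub>C x"
  have u: "u \<in> V" "N u = 1" "cmod (f u) = cmod (f x) / N x"
    using x pos by (simp_all add: u_def scale hom norm_divide)
  have "cmod (f u) \<le> dual_norm V N f"
    unfolding dual_norm_def
    by (rule cSUP_upper[OF _ bdd_above_dual_norm[OF bound]]) (use u in auto)
  then show ?thesis using u pos by (simp add: field_simps)
qed

lemma dual_norm_le:
  assumes "0 \<le> b" "\<And>x. x \<in> V \<Longrightarrow> cmod (f x) \<le> b * N x"
  shows "dual_norm V N f \<le> b"
  unfolding dual_norm_def
proof (rule cSUP_least)
  fix x assume x: "x \<in> {x\<in>V. N x \<le> 1}"
  then have "cmod (f x) \<le> b * N x" using assms by blast
  also have "\<dots> \<le> b * 1" using x assms(1) by (intro mult_left_mono) auto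
  finally show "cmod (f x) \<le> b" by simp
qed (auto intro: exI[of _ 0])

end

lemma dual_norm_cong:
  "(\<And>x. x \<in> V \<Longrightarrow> cmod (f x) = cmod (g x)) \<Longrightarrow> dual_norm V N f = dual_norm V N g"
  unfolding dual_norm_def by (intro arg_cong[where f = Sup] image_cong) auto

text \<open>The abstract setting for \<open>B = \<Omega> + \<Upsilon>\<close>:
  \<open>nondegenerate\<close> and \<open>onto\<close> are the two conditions by which
  \<open>form_perturbations\<close> selects \<open>\<Upsilon>\<close>.\<close>

locale bijective_form = normed_subspace V N
  for V :: "'v::complex_vector set" and N :: "'v \<Rightarrow> real" +
  fixes B :: "'v \<Rightarrow> 'v \<Rightarrow> complex" and \<beta> :: real
  assumes sesquilinear: "sesquilinear_on V B"
    and bounded: "x \<in> V \<Longrightarrow> y \<in> V \<Longrightarrow> cmod (B x y) \<le> \<beta> * N x * N y"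
    and complete: "complete_wrt V N"
    and nondegenerate: "x \<in> V \<Longrightarrow> (\<And>y. y \<in> V \<Longrightarrow> B x y = 0) \<Longrightarrow> x = 0"
    and onto: "\<Lambda> \<in> conj_dual_space V N \<Longrightarrow> \<exists>x\<in>V. \<forall>y\<in>V. \<Lambda> y = B x y"
begin

lemma form_add_left: "x \<in> V \<Longrightarrow> y \<in> V \<Longrightarrow> z \<in> V \<Longrightarrow> B (x + y) z = B x z + B y z"
  and form_scale_left: "x \<in> V \<Longrightarrow> z \<in> V \<Longrightarrow> B (c *\<^sub>C x) z = c * B x z"
  and form_add_right: "x \<in> V \<Longrightarrow> y \<in> V \<Longrightarrow> z \<in> V \<Longrightarrow> B z (x + y) = B z x + B z y"
  and form_scale_right: "x \<in> V \<Longrightarrow> z \<in> V \<Longrightarrow> B z (c *\<^sub>C x) = cnj c * B z x"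
  using sesquilinear by (auto simp: sesquilinear_on_def)

lemma form_diff_left: "x \<in> V \<Longrightarrow> y \<in> V \<Longrightarrow> z \<in> V \<Longrightarrow> B (x - y) z = B x z - B y z"
  using form_add_left[of "x - y" y z] by simp

lemma form_eqI:
  assumes "x \<in> V" "y \<in> V" "\<And>z. z \<in> V \<Longrightarrow> B x z = B y z"
  shows "x = y"
  using nondegenerate[of "x - y"] assms by (simp add: form_diff_left)

text \<open>The norm pulled back from the conjugate dual along the map from \<open>x\<close> to
  \<open>B x\<close>.\<close>

abbreviation form_norm :: "'v \<Rightarrow> real"
  where "form_norm x \<equiv> dual_norm V N (B x)"

lemma form_norm_nonneg: "x \<in> V \<Longrightarrow> 0 \<le> form_norm x"
  by (rule dual_norm_nonneg[of _ "\<beta> * N x"]) (rule bounded)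

lemma form_le_form_norm: "x \<in> V \<Longrightarrow> y \<in> V \<Longrightarrow> cmod (B x y) \<le> form_norm x * N y"
  by (rule norm_le_dual_norm[of _ "\<beta> * N x"])
    (auto simp: form_scale_right norm_mult intro: bounded)

text \<open>Definiteness is nondegeneracy of \<open>B\<close>. Exact homogeneity follows from the
  inequality \<open>le\<close>, used for \<open>c\<close> and for \<open>1 / c\<close>.\<close>

lemma normed_subspace_form_norm: "normed_subspace V form_norm"
proof (unfold_locales, rule subspace)
  have le: "form_norm (c *\<^sub>C x) \<le> cmod c * form_norm x" if "x \<in> V" for c x
  proof (rule dual_norm_le)
    show "0 \<le> cmod c * form_norm x" using form_norm_nonneg[OF that] by simp
    show "cmod (B (c *\<^sub>C x) y) \<le> cmod c * form_norm x * N y" if "y \<in> V" for y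
      using form_le_form_norm[OF \<open>x \<in> V\<close> that] \<open>x \<in> V\<close> that
      by (simp add: form_scale_left norm_mult mult.assoc mult_left_mono)
  qed
  have scale: "form_norm (c *\<^sub>C x) = cmod c * form_norm x" if x: "x \<in> V" for c x
  proof (cases "c = 0")
    case True
    then show ?thesis using le[OF x, of c] form_norm_nonneg[of "c *\<^sub>C x"] x by simp
  next
    case False
    then have "form_norm x \<le> cmod (1 / c) * form_norm (c *\<^sub>C x)"
      using le[of "c *\<^sub>C x" "1 / c"] x by (simp add: scaleC_scaleC scaleC_one)
    then have "cmod c * form_norm x \<le> form_norm (c *\<^sub>C x)"
      using False by (simp add: norm_divide field_simps)
    then show ?thesis using le[OF x, of c] by simp
  qed
  have zero: "form_norm x = 0 \<longleftrightarrow> x = 0" if x: "x \<in> V" for x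
  proof
    assume "form_norm x = 0"
    then show "x = 0"
      using form_le_form_norm[OF x] nondegenerate[OF x] by simp
  next
    assume "x = 0"
    then show "form_norm x = 0"
      using scale[OF x, of 0] by simp
  qed
  have "form_norm (x + y) \<le> form_norm x + form_norm y" if xy: "x \<in> V" "y \<in> V" for x y
  proof (rule dual_norm_le)
    show "0 \<le> form_norm x + form_norm y" using form_norm_nonneg xy by simp
    fix z assume z: "z \<in> V"
    have "cmod (B (x + y) z) \<le> cmod (B x z) + cmod (B y z)"
      using xy z by (simp add: form_add_left norm_triangle_ineq)
    also have "\<dots> \<le> (form_norm x + form_norm y) * N z"
      using form_le_form_norm xy z by (auto simp: distrib_right intro: add_mono)
    finally show "cmod (B (x + y) z) \<le> (form_norm x + form_norm y) * N z" .
  qed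
  with scale zero form_norm_nonneg show "norm_on V form_norm"
    by (simp add: norm_on_def)
qed

text \<open>The dual is complete and all of it is reached: the pointwise limit \<open>L\<close> of
  the functionals \<open>B (X n)\<close> is bounded and conjugate linear, so \<open>onto\<close>
  writes it as \<open>B x\<close>, and \<open>x\<close> is the limit.\<close>

lemma complete_form_norm: "complete_wrt V form_norm"
  unfolding complete_wrt_def
proof (intro allI impI)
  interpret F: normed_subspace V form_norm by (rule normed_subspace_form_norm)
  fix X assume "\<forall>n. X n \<in> V" and Cauchy: "Cauchy_wrt form_norm X"
  then have X: "X n \<in> V" for n by simp
  define L where "L y = (if y \<in> V then lim (\<lambda>n. B (X n) y) else 0)" for y
  have diff_le: "cmod (B (X m) y - B (X n) y) \<le> form_norm (X m - X n) * N y"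
    if "y \<in> V" for m n y
    using form_le_form_norm[of "X m - X n" y] that X by (simp add: form_diff_left)
  have lim: "(\<lambda>n. B (X n) y) \<longlonglongrightarrow> L y" if y: "y \<in> V" for y
  proof -
    have "Cauchy (\<lambda>n. B (X n) y)"
    proof (rule CauchyI)
      fix e :: real assume "0 < e"
      \<comment> \<open>The added 1 keeps the denominator positive when
        \<open>N y = 0\<close>.\<close>
      then have "e / (N y + 1) > 0" using nonneg[OF y] by (simp add: add_nonneg_pos)
      with Cauchy obtain M where M: "\<forall>m\<ge>M. \<forall>n\<ge>M. form_norm (X m - X n) < e / (N y + 1)"
        unfolding Cauchy_wrt_def by blast
      show "\<exists>M. \<forall>m\<ge>M. \<forall>n\<ge>M. norm (B (X m) y - B (X n) y) < e"
      proof (intro exI allI impI)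
        fix m n assume "M \<le> m" "M \<le> n"
        have "cmod (B (X m) y - B (X n) y) \<le> form_norm (X m - X n) * N y"
          by (rule diff_le[OF y])
        also have "\<dots> \<le> e / (N y + 1) * N y"
          using M \<open>M \<le> m\<close> \<open>M \<le> n\<close> y by (intro mult_right_mono) (auto simp: less_imp_le)
        also have "\<dots> < e"
          using \<open>0 < e\<close> nonneg[OF y] by (simp add: field_simps add_pos_nonneg del: nonneg)
        finally show "norm (B (X m) y - B (X n) y) < e" .
      qed
    qed
    then show ?thesis
      using y by (simp add: L_def Cauchy_convergent_iff convergent_LIMSEQ_iff)
  qed
  \<comment> \<open>Letting \<open>m\<close> tend to infinity in the Cauchy estimate makes the
    pointwise convergence uniform relative to \<open>N y\<close>.\<close>
  have L_close: "\<exists>M. \<forall>n\<ge>M. \<forall>y\<in>V. cmod (B (X n) y - L y) \<le> e * N y" if "0 < e" for e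
  proof -
    obtain M where M: "\<And>m n. m \<ge> M \<Longrightarrow> n \<ge> M \<Longrightarrow> form_norm (X m - X n) < e"
      using Cauchy \<open>0 < e\<close> unfolding Cauchy_wrt_def by blast
    have "cmod (B (X n) y - L y) \<le> e * N y" if "n \<ge> M" "y \<in> V" for n y
    proof (rule LIMSEQ_le_const2)
      show "(\<lambda>m. cmod (B (X n) y - B (X m) y)) \<longlonglongrightarrow> cmod (B (X n) y - L y)"
        by (intro tendsto_intros lim that)
      have "cmod (B (X n) y - B (X m) y) \<le> e * N y" if "m \<ge> M" for m
        using diff_le[OF \<open>y \<in> V\<close>, of n m] M[OF \<open>n \<ge> M\<close> that] nonneg[OF \<open>y \<in> V\<close>]
        by (meson less_imp_le mult_right_mono order_trans)
      then show "\<exists>M. \<forall>m\<ge>M. cmod (B (X n) y - B (X m) y) \<le> e * N y" by blast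
    qed
    then show ?thesis by blast
  qed
  have "L \<in> conj_dual_space V N"
    unfolding conj_dual_space_def
  proof (intro CollectI conjI allI ballI impI)
    show "L (x + y) = L x + L y" if "x \<in> V" "y \<in> V" for x y
    proof (rule LIMSEQ_unique[OF lim])
      show "(\<lambda>n. B (X n) (x + y)) \<longlonglongrightarrow> L x + L y"
        using tendsto_add[OF lim lim] that X by (simp add: form_add_right)
    qed (use that in simp)
    show "L (c *\<^sub>C x) = cnj c * L x" if "x \<in> V" for c x
    proof (rule LIMSEQ_unique[OF lim])
      show "(\<lambda>n. B (X n) (c *\<^sub>C x)) \<longlonglongrightarrow> cnj c * L x"
        using tendsto_mult_left[OF lim] that X by (simp add: form_scale_right)
    qed (use that in simp)
    obtain M where M: "\<And>y. y \<in> V \<Longrightarrow> cmod (B (X M) y - L y) \<le> 1 * N y"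
      using L_close[of 1] by auto
    have "cmod (L y) \<le> (form_norm (X M) + 1) * N y" if "y \<in> V" for y
      using norm_triangle_ineq4[of "B (X M) y" "B (X M) y - L y"] M[OF that]
        form_le_form_norm[OF X that, of M]
      by (simp add: algebra_simps)
    then show "\<exists>b. \<forall>y\<in>V. cmod (L y) \<le> b * N y" by blast
  qed (simp add: L_def)
  then obtain x where x: "x \<in> V" "\<And>y. y \<in> V \<Longrightarrow> L y = B x y"
    using onto by blast
  have "(\<lambda>n. form_norm (X n - x)) \<longlonglongrightarrow> 0"
  proof (rule LIMSEQ_I)
    fix e :: real assume "0 < e"
    then obtain M where M: "\<And>n y. n \<ge> M \<Longrightarrow> y \<in> V \<Longrightarrow> cmod (B (X n) y - L y) \<le> e / 2 * N y"
      using L_close[of "e / 2"] by auto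
    have "form_norm (X n - x) \<le> e / 2" if "n \<ge> M" for n
      using M[OF that] x X \<open>0 < e\<close> by (intro dual_norm_le) (auto simp: form_diff_left)
    then show "\<exists>M. \<forall>n\<ge>M. norm (form_norm (X n - x) - 0) < e"
      using \<open>0 < e\<close> F.nonneg X x(1) by (intro exI[of _ M]) fastforce
  qed
  with x(1) show "\<exists>x\<in>V. (\<lambda>n. form_norm (X n - x)) \<longlonglongrightarrow> 0" by blast
qed

text \<open>Serves as the bounded inverse theorem for the map from \<open>x\<close> to
  \<open>B x\<close>: boundedness of \<open>B\<close> dominates \<open>form_norm\<close> by
  \<open>N\<close>, and both norms are complete.\<close>

lemma norm_le_form_norm: "\<exists>K. \<forall>x\<in>V. N x \<le> K * form_norm x"
proof (rule comparable_complete_norms)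
  show "normed_subspace V N" by unfold_locales
  show "normed_subspace V form_norm" by (rule normed_subspace_form_norm)
  show "complete_wrt V N" by (rule complete)
  show "complete_wrt V form_norm" by (rule complete_form_norm)
  fix x assume x: "x \<in> V"
  have "cmod (B x y) \<le> \<bar>\<beta>\<bar> * N x * N y" if "y \<in> V" for y
    using bounded[OF x that] x that
    by (smt (verit) mult_right_mono nonneg)
  then show "form_norm x \<le> \<bar>\<beta>\<bar> * N x"
    using x by (intro dual_norm_le) auto
qed

text \<open>A functional \<open>\<Lambda>\<close> composed with the inverse of \<open>x \<mapsto> B x\<close> is an element of the bidual; by
  reflexivity it is evaluation at a point, which represents \<open>\<Lambda>\<close> through the adjoint form.\<close>

lemma form_adjoint_onto:
  assumes reflexive: "reflexive_wrt V N" and \<Lambda>: "\<Lambda> \<in> conj_dual_space V N"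
  shows "\<exists>x\<in>V. \<forall>y\<in>V. \<Lambda> y = form_adjoint B x y"
proof -
  obtain K where K: "\<And>x. x \<in> V \<Longrightarrow> N x \<le> K * form_norm x"
    using norm_le_form_norm by blast
  obtain b where b: "\<And>x. x \<in> V \<Longrightarrow> cmod (\<Lambda> x) \<le> b * N x"
    and \<Lambda>_add: "\<And>x y. x \<in> V \<Longrightarrow> y \<in> V \<Longrightarrow> \<Lambda> (x + y) = \<Lambda> x + \<Lambda> y"
    and \<Lambda>_scale: "\<And>c x. x \<in> V \<Longrightarrow> \<Lambda> (c *\<^sub>C x) = cnj c * \<Lambda> x"
    using \<Lambda> unfolding conj_dual_space_def by blast
  let ?V' = "dual_space V N"
  \<comment> \<open>Conjugation turns a linear functional into a conjugate linear one, to which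
    \<open>onto\<close> applies. The resulting \<open>R\<close> is conjugate linear, so
    \<open>\<Lambda>\<close> after \<open>R\<close> is linear, as the bidual requires.\<close>
  have "\<exists>x\<in>V. \<forall>y\<in>V. cnj (f y) = B x y" if "f \<in> ?V'" for f
    using onto[of "\<lambda>y. cnj (f y)"] that by (auto simp: dual_space_def conj_dual_space_def)
  then obtain R where R: "\<And>f. f \<in> ?V' \<Longrightarrow> R f \<in> V"
    and R_eq: "\<And>f y. f \<in> ?V' \<Longrightarrow> y \<in> V \<Longrightarrow> B (R f) y = cnj (f y)"
    by metis
  have add_in: "f + g \<in> ?V'" if fg: "f \<in> ?V'" "g \<in> ?V'" for f g
  proof -
    obtain b c where "\<forall>x\<in>V. cmod (f x) \<le> b * N x" "\<forall>x\<in>V. cmod (g x) \<le> c * N x"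
      using fg unfolding dual_space_def by blast
    then have "cmod (f x + g x) \<le> (b + c) * N x" if "x \<in> V" for x
      using that norm_triangle_ineq[of "f x" "g x"] by (smt (verit) distrib_right)
    with fg show ?thesis
      by (auto simp: dual_space_def distrib_left)
  qed
  have scale_in: "c *\<^sub>C f \<in> ?V'" if f: "f \<in> ?V'" for c f
  proof -
    obtain b where "\<forall>x\<in>V. cmod (f x) \<le> b * N x"
      using f unfolding dual_space_def by blast
    then have "\<forall>x\<in>V. cmod (c * f x) \<le> (cmod c * b) * N x"
      by (simp add: norm_mult mult.assoc mult_left_mono)
    with f show ?thesis
      unfolding dual_space_def
      by (auto simp: scaleC_fun_def scaleC_complex_def distrib_left simp del: norm_mult)
  qed
  have R_add: "R (f + g) = R f + R g" if "f \<in> ?V'" "g \<in> ?V'" for f g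
    using that R by (intro form_eqI) (auto simp: R_eq add_in form_add_left)
  have R_scale: "R (c *\<^sub>C f) = cnj c *\<^sub>C R f" if "f \<in> ?V'" for c f
  proof (rule form_eqI)
    show "B (R (c *\<^sub>C f)) z = B (cnj c *\<^sub>C R f) z" if "z \<in> V" for z
      using that \<open>f \<in> ?V'\<close> R
      by (simp add: R_eq scale_in form_scale_left) (simp add: scaleC_fun_def scaleC_complex_def)
  qed (use that R scale_in in auto)
  \<comment> \<open>Continuity of \<open>R\<close>: \<open>norm_le_form_norm\<close> bounds
    \<open>N (R f)\<close>, and \<open>form_norm (R f)\<close> is the dual norm of \<open>f\<close>
    because \<open>B (R f)\<close> is the conjugate of \<open>f\<close> on \<open>V\<close>.\<close>
  have bound: "cmod (\<Lambda> (R f)) \<le> \<bar>b\<bar> * K * dual_norm V N f" if f: "f \<in> ?V'" for f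
  proof -
    have "cmod (\<Lambda> (R f)) \<le> \<bar>b\<bar> * N (R f)"
      using b[OF R[OF f]] nonneg[OF R[OF f]] by (smt (verit) mult_right_mono)
    also have "\<dots> \<le> \<bar>b\<bar> * (K * form_norm (R f))"
      by (intro mult_left_mono K R f) simp
    also have "form_norm (R f) = dual_norm V N f"
      by (rule dual_norm_cong) (simp add: R_eq f)
    finally show ?thesis by simp
  qed
  define \<Phi> where "\<Phi> f = (if f \<in> ?V' then \<Lambda> (R f) else 0)" for f
  have "\<Phi> \<in> dual_space ?V' (dual_norm V N)"
    unfolding dual_space_def[of ?V']
  proof (intro CollectI conjI allI ballI impI)
    show "\<exists>b. \<forall>f\<in>?V'. cmod (\<Phi> f) \<le> b * dual_norm V N f"
      using bound by (intro exI[of _ "\<bar>b\<bar> * K"]) (simp add: \<Phi>_def)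
  qed (simp_all add: \<Phi>_def add_in scale_in R R_add R_scale \<Lambda>_add \<Lambda>_scale)
  then obtain x where x: "x \<in> V" "\<And>f. f \<in> ?V' \<Longrightarrow> \<Phi> f = f x"
    using reflexive unfolding reflexive_wrt_def by blast
  have "\<Lambda> y = form_adjoint B x y" if y: "y \<in> V" for y
  proof -
    \<comment> \<open>For \<open>f\<close> the conjugate of \<open>B y\<close>,
      \<open>R f = y\<close>, so \<open>\<Lambda> y = \<Phi> f = f x\<close>, which is the adjoint
      form at \<open>x\<close> and \<open>y\<close>.\<close>
    define f where "f z = (if z \<in> V then cnj (B y z) else 0)" for z
    have f: "f \<in> ?V'"
      using y bounded[OF y]
      by (auto simp: dual_space_def f_def form_add_right form_scale_right intro!: exI[of _ "\<beta> * N y"])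
    have "R f = y"
      using R[OF f] y by (intro form_eqI) (simp_all add: R_eq f, simp add: f_def)
    then show ?thesis
      using x(2)[OF f] x(1) f by (simp add: \<Phi>_def f_def form_adjoint_def)
  qed
  with x(1) show ?thesis by blast
qed

end

section \<open>Riesz representation\<close>

lemma cinner_minus_left: "cinner (- x) y = - cinner x (y::'a::complex_hilbert_space)"
  using cinner_scaleC_left[of "-1" x y] by simp

lemma cinner_diff_left: "cinner (x - y) z = cinner x z - cinner y (z::'a::complex_hilbert_space)"
  using cinner_add_left[of x "- y" z] by (simp add: cinner_minus_left)

lemma cinner_add_right: "cinner x (y + z) = cinner x y + cinner x (z::'a::complex_hilbert_space)"
  using arg_cong[OF cinner_add_left[of y z x], of cnj] by (simp flip: cinner_commute)

lemma cinner_scaleC_right: "cinner x (c *\<^sub>C y) = cnj c * cinner x (y::'a::complex_hilbert_space)"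
  using arg_cong[OF cinner_scaleC_left[of c y x], of cnj] by (simp flip: cinner_commute)

lemma cinner_diff_right: "cinner x (y - z) = cinner x y - cinner x (z::'a::complex_hilbert_space)"
  using arg_cong[OF cinner_diff_left[of y z x], of cnj] by (simp flip: cinner_commute)

lemma norm_power2_cinner: "(norm x)\<^sup>2 = Re (cinner x (x::'a::complex_hilbert_space))"
  by (simp add: norm_eq_sqrt_cinner cinner_ge_zero)

lemma cinner_self: "cinner x x = complex_of_real ((norm (x::'a::complex_hilbert_space))\<^sup>2)"
proof -
  have "Im (cinner x x) = 0"
    using arg_cong[OF cinner_commute[of x x], of Im] by simp
  then show ?thesis
    by (simp add: complex_eq_iff norm_power2_cinner)
qed

lemma norm_add_power2:
  "(norm (x + y))\<^sup>2 = (norm x)\<^sup>2 + 2 * Re (cinner x y) + (norm (y::'a::complex_hilbert_space))\<^sup>2"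
  using arg_cong[OF cinner_commute[of y x], of Re]
  by (simp add: norm_power2_cinner cinner_add_left cinner_add_right)

lemma norm_scaleC: "norm (c *\<^sub>C x) = cmod c * norm (x::'a::complex_hilbert_space)"
proof (rule power2_eq_imp_eq)
  have "cinner (c *\<^sub>C x) (c *\<^sub>C x) = c * cnj c * cinner x x"
    by (simp add: cinner_scaleC_left cinner_scaleC_right)
  also have "\<dots> = complex_of_real ((cmod c)\<^sup>2 * (norm x)\<^sup>2)"
    by (simp add: cinner_self flip: complex_norm_square)
  finally show "(norm (c *\<^sub>C x))\<^sup>2 = (cmod c * norm x)\<^sup>2"
    by (simp add: norm_power2_cinner[of "c *\<^sub>C x"] power_mult_distrib)
qed auto

lemma cinner_Cauchy_Schwarz:
  "cmod (cinner x y) \<le> norm x * norm (y::'a::complex_hilbert_space)"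
proof (cases "y = 0")
  case True
  then show ?thesis using cinner_scaleC_right[of x 0 y] by simp
next
  case False
  define n where "n = (norm y)\<^sup>2"
  \<comment> \<open>This \<open>c\<close> makes \<open>x + c *\<^sub>C y\<close> orthogonal to
    \<open>y\<close>.\<close>
  define c where "c = - cinner x y / complex_of_real n"
  have n: "n > 0" using False by (simp add: n_def)
  have "(norm (x + c *\<^sub>C y))\<^sup>2 = (norm x)\<^sup>2 - (cmod (cinner x y))\<^sup>2 / n"
  proof -
    have "cnj c * cinner x y = - complex_of_real ((cmod (cinner x y))\<^sup>2 / n)"
      by (simp add: c_def mult.commute flip: complex_norm_square)
    then have "Re (cinner x (c *\<^sub>C y)) = - ((cmod (cinner x y))\<^sup>2 / n)"
      by (simp only: cinner_scaleC_right uminus_complex.sel Re_complex_of_real)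
    moreover have "(norm (c *\<^sub>C y))\<^sup>2 = (cmod (cinner x y))\<^sup>2 / n"
      using n by (simp add: norm_scaleC c_def norm_divide power_mult_distrib power_divide
          flip: n_def) (simp add: power2_eq_square)
    ultimately show ?thesis by (simp add: norm_add_power2)
  qed
  then have "(cmod (cinner x y))\<^sup>2 / n \<le> (norm x)\<^sup>2"
    by (metis diff_ge_0_iff_ge zero_le_power2)
  then have "(cmod (cinner x y))\<^sup>2 \<le> (norm x * norm y)\<^sup>2"
    using n by (simp add: pos_divide_le_eq power_mult_distrib n_def)
  then show ?thesis by (rule power2_le_imp_le) simp
qed

text \<open>The representing vector minimises \<open>\<parallel>x\<parallel>\<^sup>2 - 2 Re (f x)\<close>; by the parallelogram law
  minimising sequences are Cauchy.\<close>

theorem Riesz_representation: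
  fixes f :: "'a::complex_hilbert_space \<Rightarrow> complex"
  assumes add: "\<And>x y. f (x + y) = f x + f y"
    and scale: "\<And>c x. f (c *\<^sub>C x) = cnj c * f x"
    and bound: "\<And>x. cmod (f x) \<le> b * norm x"
  obtains z where "\<And>x. f x = cinner z x"
proof -
  define J where "J x = (norm x)\<^sup>2 - 2 * Re (f x)" for x
  have diff: "f (x - y) = f x - f y" for x y
    using add[of "x - y" y] by simp
  \<comment> \<open>Completing the square:
    \<open>J x \<ge> (norm x - b)\<^sup>2 - b\<^sup>2\<close>.\<close>
  have "- b\<^sup>2 \<le> J x" for x
  proof -
    have "Re (f x) \<le> b * norm x"
      using bound[of x] complex_Re_le_cmod[of "f x"] by simp
    moreover have "0 \<le> (norm x - b)\<^sup>2" by simp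
    ultimately show ?thesis by (simp add: J_def power2_diff algebra_simps)
  qed
  then have bdd: "bdd_below (range J)" by (intro bdd_belowI2)
  define i where "i = Inf (range J)"
  have i_le: "i \<le> J x" for x
    unfolding i_def by (rule cInf_lower[OF _ bdd]) simp
  have "\<exists>x. J x < i + 1 / real (Suc n)" for n
    using cInf_lessD[of "range J" "i + 1 / real (Suc n)"] by (auto simp: i_def)
  then obtain X where X: "\<And>n. J (X n) < i + 1 / real (Suc n)" by metis
  have parallelogram: "(norm (x - y))\<^sup>2 \<le> 2 * (J x - i) + 2 * (J y - i)" for x y
  proof -
    \<comment> \<open>With the midpoint \<open>m\<close> the terms in \<open>f\<close> cancel, so
      the squared distance equals \<open>2 * J x + 2 * J y - 4 * J m\<close>, where
      \<open>J m \<ge> i\<close>.\<close>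
    define m where "m = (1 / 2) *\<^sub>C (x + y)"
    have "(norm (x - y))\<^sup>2 = 2 * (norm x)\<^sup>2 + 2 * (norm y)\<^sup>2 - (norm (x + y))\<^sup>2"
      using norm_add_power2[of x y] norm_add_power2[of "x - y" y]
      by (simp add: cinner_diff_left) (simp add: norm_power2_cinner)
    also have "(norm (x + y))\<^sup>2 = 4 * (norm m)\<^sup>2"
      by (simp add: m_def norm_scaleC norm_divide power_mult_distrib power_divide)
    also have "2 * (norm x)\<^sup>2 + 2 * (norm y)\<^sup>2 - 4 * (norm m)\<^sup>2 = 2 * J x + 2 * J y - 4 * J m"
      by (simp add: J_def m_def add scale field_simps)
    finally show ?thesis using i_le[of m] by simp
  qed
  have "Cauchy X"
  proof (rule CauchyI)
    fix e :: real assume "0 < e"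
    then obtain M where M: "1 / real (Suc M) < e\<^sup>2 / 4"
      using nat_approx_posE[of "e\<^sup>2 / 4"] by auto
    show "\<exists>M. \<forall>m\<ge>M. \<forall>n\<ge>M. norm (X m - X n) < e"
    proof (intro exI allI impI)
      have small: "J (X n) - i < e\<^sup>2 / 4" if "n \<ge> M" for n
      proof -
        have "1 / real (Suc n) \<le> 1 / real (Suc M)" using that by (simp add: field_simps)
        then show ?thesis using X[of n] M by simp
      qed
      fix m n assume "M \<le> m" "M \<le> n"
      then have "(norm (X m - X n))\<^sup>2 < e\<^sup>2"
        using parallelogram[of "X m" "X n"] small[of m] small[of n] by simp
      then show "norm (X m - X n) < e"
        using \<open>0 < e\<close> by (simp add: power2_less_imp_less)
    qed
  qed
  then obtain z where z: "X \<longlonglongrightarrow> z"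
    by (auto simp: Cauchy_convergent_iff convergent_def)
  have "(\<lambda>n. f (X n) - f z) \<longlonglongrightarrow> 0"
  proof (rule Lim_null_comparison)
    show "\<forall>\<^sub>F n in sequentially. cmod (f (X n) - f z) \<le> b * norm (X n - z)"
      using bound by (simp flip: diff)
    show "(\<lambda>n. b * norm (X n - z)) \<longlonglongrightarrow> 0"
      by (intro tendsto_mult_right_zero tendsto_norm_zero LIM_zero z)
  qed
  then have "(\<lambda>n. f (X n)) \<longlonglongrightarrow> f z" by (rule LIM_zero_cancel)
  then have "(\<lambda>n. J (X n)) \<longlonglongrightarrow> J z"
    unfolding J_def using z by (intro tendsto_intros)
  moreover have "(\<lambda>n. i + 1 / real (Suc n)) \<longlonglongrightarrow> i"
    using tendsto_add[OF tendsto_const LIMSEQ_inverse_real_of_nat, of i] by (simp add: inverse_eq_divide)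
  ultimately have "J z \<le> i"
    by (rule LIMSEQ_le) (use X in \<open>auto simp: less_imp_le\<close>)
  have "f y = cinner z y" for y
  proof -
    define g where "g = cinner z y - f y"
    \<comment> \<open>Moving the minimiser \<open>z\<close> by \<open>c *\<^sub>C y\<close> changes
      \<open>J\<close> by \<open>- 2 * t * (cmod g)\<^sup>2\<close> plus a quadratic term, which is
      at most \<open>t * (cmod g)\<^sup>2\<close> for this small \<open>t\<close>; so
      \<open>g\<close> vanishes. The 1 in the denominator covers \<open>y = 0\<close>.\<close>
    define t where "t = 1 / ((norm y)\<^sup>2 + 1)"
    define c where "c = - complex_of_real t * g"
    have t: "t > 0" "t * (norm y)\<^sup>2 < 1"
      by (simp_all add: t_def add_nonneg_pos)
    have "J z \<le> J (z + c *\<^sub>C y)"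
      using \<open>J z \<le> i\<close> i_le by (rule order_trans)
    then have "0 \<le> 2 * Re (cnj c * g) + (norm (c *\<^sub>C y))\<^sup>2"
      by (simp add: J_def norm_add_power2 add scale cinner_scaleC_right g_def algebra_simps)
    moreover have "Re (cnj c * g) = - t * (cmod g)\<^sup>2"
    proof -
      have "cnj c * g = complex_of_real (- t * (cmod g)\<^sup>2)"
        by (simp add: c_def mult.assoc mult.commute[of "cnj g"] flip: complex_norm_square)
      then show ?thesis by (simp only: Re_complex_of_real)
    qed
    moreover have "(norm (c *\<^sub>C y))\<^sup>2 = t * (cmod g)\<^sup>2 * (t * (norm y)\<^sup>2)"
      by (simp add: norm_scaleC c_def norm_mult power_mult_distrib power2_eq_square)
    ultimately have "0 \<le> t * (cmod g)\<^sup>2 * (t * (norm y)\<^sup>2 - 2)"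
      by (simp only: right_diff_distrib)
    then have "(cmod g)\<^sup>2 \<le> 0"
      using t by (simp add: zero_le_mult_iff mult_le_0_iff)
    then show ?thesis by (simp add: g_def)
  qed
  then show thesis by (rule that)
qed


section \<open>Adjoint forms\<close>

lemma form_adjoint_form_adjoint [simp]: "form_adjoint (form_adjoint \<Omega>) = \<Omega>"
  by (simp add: form_adjoint_def)

lemma sesquilinear_on_form_adjoint: "sesquilinear_on D \<Omega> \<Longrightarrow> sesquilinear_on D (form_adjoint \<Omega>)"
  by (simp add: sesquilinear_on_def form_adjoint_def)

lemma bounded_sesquilinear_form_adjoint:
  assumes "bounded_sesquilinear \<Upsilon>"
  shows "bounded_sesquilinear (form_adjoint \<Upsilon>)"
proof -
  obtain b where "\<And>\<xi> \<eta>. cmod (\<Upsilon> \<xi> \<eta>) \<le> b * norm \<xi> * norm \<eta>"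
    using assms unfolding bounded_sesquilinear_def by blast
  then have "cmod (form_adjoint \<Upsilon> \<xi> \<eta>) \<le> b * norm \<xi> * norm \<eta>" for \<xi> \<eta>
    by (simp add: form_adjoint_def mult.assoc mult.commute[of "norm \<xi>"])
  then show ?thesis
    using assms sesquilinear_on_form_adjoint unfolding bounded_sesquilinear_def by blast
qed

text \<open>Only sesquilinearity and the bound \<open>\<beta>\<close> involve the form, and both
  survive swapping the arguments and conjugating; the other conditions concern \<open>N\<close>
  alone.\<close>

lemma q_closed_form_adjoint:
  assumes "q_closed D N \<Omega>"
  shows "q_closed D N (form_adjoint \<Omega>)"
proof -
  obtain \<beta> where "\<beta> > 0"
    and \<beta>: "\<And>\<xi> \<eta>. \<xi> \<in> D \<Longrightarrow> \<eta> \<in> D \<Longrightarrow> cmod (\<Omega> \<xi> \<eta>) \<le> \<beta> * N \<xi> * N \<eta>"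
    using assms unfolding q_closed_def by blast
  have "cmod (form_adjoint \<Omega> \<xi> \<eta>) \<le> \<beta> * N \<xi> * N \<eta>" if "\<xi> \<in> D" "\<eta> \<in> D" for \<xi> \<eta>
    using \<beta>[OF that(2,1)] by (simp add: form_adjoint_def ac_simps)
  with \<open>\<beta> > 0\<close>
  have "\<exists>\<beta>>0. \<forall>\<xi>\<in>D. \<forall>\<eta>\<in>D. cmod (form_adjoint \<Omega> \<xi> \<eta>) \<le> \<beta> * N \<xi> * N \<eta>"
    by blast
  then show ?thesis
    using assms sesquilinear_on_form_adjoint unfolding q_closed_def by blast
qed

text \<open>A functional bounded on the Hilbert space is \<open>N\<close>-bounded on
  \<open>D\<close>, because \<open>norm\<close> is at most \<open>\<alpha> * N\<close> there; its
  restriction thus lies in the conjugate dual.\<close>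

lemma form_perturbation_represents:
  fixes f :: "'a::complex_hilbert_space \<Rightarrow> complex"
  assumes "complex_vector.subspace D" "q_closed D N \<Omega>" "\<Upsilon> \<in> form_perturbations D N \<Omega>"
    and f_add: "\<And>x y. f (x + y) = f x + f y"
    and f_scale: "\<And>c x. f (c *\<^sub>C x) = cnj c * f x"
    and bound: "\<And>x. cmod (f x) \<le> b * norm x"
  shows "\<exists>\<xi>\<in>D. \<forall>\<eta>\<in>D. f \<eta> = \<Omega> \<xi> \<eta> + \<Upsilon> \<xi> \<eta>"
proof -
  interpret normed_subspace D N
    using assms(1,2) by unfold_locales (simp_all add: q_closed_def)
  obtain \<alpha> where \<alpha>: "\<alpha> > 0" "\<And>\<xi>. \<xi> \<in> D \<Longrightarrow> norm \<xi> \<le> \<alpha> * N \<xi>"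
    using assms(2) unfolding q_closed_def by blast
  define \<Lambda> where "\<Lambda> x = (if x \<in> D then f x else 0)" for x
  have "cmod (\<Lambda> x) \<le> \<bar>b\<bar> * \<alpha> * N x" if x: "x \<in> D" for x
  proof -
    have "cmod (\<Lambda> x) \<le> \<bar>b\<bar> * norm x"
      using bound[of x] x by (simp add: \<Lambda>_def) (smt (verit) mult_right_mono norm_ge_zero)
    also have "\<dots> \<le> \<bar>b\<bar> * (\<alpha> * N x)"
      using \<alpha>(2)[OF x] by (rule mult_left_mono) simp
    finally show ?thesis by simp
  qed
  then have "\<Lambda> \<in> conj_dual_space D N"
    by (auto simp: conj_dual_space_def \<Lambda>_def f_add f_scale)
  with assms(3) have "\<exists>\<xi>\<in>D. \<forall>\<eta>\<in>D. \<Lambda> \<eta> = \<Omega> \<xi> \<eta> + \<Upsilon> \<xi> \<eta>"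
    by (simp add: form_perturbations_def)
  then show ?thesis by (simp add: \<Lambda>_def)
qed

text \<open>Surjectivity is \<open>form_adjoint_onto\<close>. For injectivity,
  \<open>cinner \<xi>\<close> is written as \<open>B \<zeta>\<close> on \<open>D\<close> and
  evaluated at \<open>\<xi>\<close>: \<open>cinner \<xi> \<xi>\<close> is then conjugate to the
  adjoint form at \<open>\<xi>\<close> and \<open>\<zeta>\<close>, which vanishes.\<close>

lemma form_adjoint_in_form_perturbations:
  fixes D :: "'a::complex_hilbert_space set"
  assumes subspace: "complex_vector.subspace D" and q_closed: "q_closed D N \<Omega>"
    and \<Upsilon>: "\<Upsilon> \<in> form_perturbations D N \<Omega>"
  shows "form_adjoint \<Upsilon> \<in> form_perturbations D N (form_adjoint \<Omega>)"
proof -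
  define B where "B \<xi> \<eta> = \<Omega> \<xi> \<eta> + \<Upsilon> \<xi> \<eta>" for \<xi> \<eta>
  obtain \<alpha> where \<alpha>: "\<alpha> > 0" "\<And>\<xi>. \<xi> \<in> D \<Longrightarrow> norm \<xi> \<le> \<alpha> * N \<xi>"
    using q_closed unfolding q_closed_def by blast
  obtain \<beta> where \<beta>: "\<And>\<xi> \<eta>. \<xi> \<in> D \<Longrightarrow> \<eta> \<in> D \<Longrightarrow> cmod (\<Omega> \<xi> \<eta>) \<le> \<beta> * N \<xi> * N \<eta>"
    using q_closed unfolding q_closed_def by blast
  have bounded_\<Upsilon>: "bounded_sesquilinear \<Upsilon>"
    and nondegenerate: "\<And>\<xi>. \<xi> \<in> D \<Longrightarrow> (\<And>\<eta>. \<eta> \<in> D \<Longrightarrow> B \<xi> \<eta> = 0) \<Longrightarrow> \<xi> = 0"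
    and onto: "\<And>\<Lambda>. \<Lambda> \<in> conj_dual_space D N \<Longrightarrow> \<exists>\<xi>\<in>D. \<forall>\<eta>\<in>D. \<Lambda> \<eta> = B \<xi> \<eta>"
    using \<Upsilon> by (auto simp: form_perturbations_def B_def)
  obtain b where b: "\<And>\<xi> \<eta>. cmod (\<Upsilon> \<xi> \<eta>) \<le> b * norm \<xi> * norm \<eta>"
    using bounded_\<Upsilon> unfolding bounded_sesquilinear_def by blast
  interpret normed_subspace D N
    using subspace q_closed by unfold_locales (simp_all add: q_closed_def)
  \<comment> \<open>\<open>\<Upsilon>\<close> is bounded in the Hilbert norm; each argument
    contributes one factor \<open>\<alpha>\<close> on passing to \<open>N\<close>.\<close>
  have "cmod (B \<xi> \<eta>) \<le> (\<beta> + \<bar>b\<bar> * \<alpha>\<^sup>2) * N \<xi> * N \<eta>" if "\<xi> \<in> D" "\<eta> \<in> D" for \<xi> \<eta>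
  proof -
    have "cmod (\<Upsilon> \<xi> \<eta>) \<le> \<bar>b\<bar> * (norm \<xi> * norm \<eta>)"
      using b[of \<xi> \<eta>] mult_right_mono[OF abs_ge_self[of b], of "norm \<xi> * norm \<eta>"]
      by (simp add: mult.assoc)
    also have "\<dots> \<le> \<bar>b\<bar> * ((\<alpha> * N \<xi>) * (\<alpha> * N \<eta>))"
      using that \<alpha> by (intro mult_left_mono mult_mono) auto
    finally have "cmod (\<Upsilon> \<xi> \<eta>) \<le> \<bar>b\<bar> * \<alpha>\<^sup>2 * N \<xi> * N \<eta>"
      by (simp add: power2_eq_square algebra_simps)
    then show ?thesis
      using \<beta>[OF that] norm_triangle_ineq[of "\<Omega> \<xi> \<eta>" "\<Upsilon> \<xi> \<eta>"]
      by (simp add: B_def distrib_right)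
  qed
  moreover have "sesquilinear_on D B"
    using q_closed bounded_\<Upsilon>
    by (simp add: q_closed_def bounded_sesquilinear_def sesquilinear_on_def B_def algebra_simps)
  ultimately interpret bijective_form D N B "\<beta> + \<bar>b\<bar> * \<alpha>\<^sup>2"
    using q_closed nondegenerate onto by unfold_locales (simp_all add: q_closed_def)
  have adjoint_B: "form_adjoint \<Omega> \<xi> \<eta> + form_adjoint \<Upsilon> \<xi> \<eta> = form_adjoint B \<xi> \<eta>" for \<xi> \<eta>
    by (simp add: form_adjoint_def B_def)
  have "\<xi> = 0" if \<xi>: "\<xi> \<in> D" and zero: "\<And>\<eta>. \<eta> \<in> D \<Longrightarrow> form_adjoint B \<xi> \<eta> = 0" for \<xi>
  proof -
    obtain \<zeta> where "\<zeta> \<in> D" "\<And>\<eta>. \<eta> \<in> D \<Longrightarrow> cinner \<xi> \<eta> = B \<zeta> \<eta>"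
      using form_perturbation_represents[OF subspace q_closed \<Upsilon>, of "cinner \<xi>" "norm \<xi>"]
        cinner_Cauchy_Schwarz[of \<xi>]
      by (auto simp: cinner_add_right cinner_scaleC_right B_def)
    then have "cinner \<xi> \<xi> = 0"
      using zero[of \<zeta>] \<xi> by (simp add: form_adjoint_def)
    then show ?thesis by (simp add: cinner_eq_zero_iff)
  qed
  moreover have "reflexive_wrt D N"
    using q_closed by (simp add: q_closed_def)
  ultimately show ?thesis
    using bounded_sesquilinear_form_adjoint[OF bounded_\<Upsilon>] form_adjoint_onto
    by (simp add: form_perturbations_def adjoint_B)
qed

section \<open>The operator associated with the adjoint form\<close>

lemma associated_operator_form_adjoint:
  fixes D :: "'a::complex_hilbert_space set"
  assumes subspace: "complex_vector.subspace D" and q_closed: "q_closed D N \<Omega>"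
    and \<Upsilon>: "\<Upsilon> \<in> form_perturbations D N \<Omega>"
  shows "associated_operator D (form_adjoint \<Omega>) = operator_adjoint (associated_operator D \<Omega>)"
proof (intro equalityI subsetI; clarify)
  fix \<eta> \<zeta> assume "(\<eta>, \<zeta>) \<in> associated_operator D (form_adjoint \<Omega>)"
  then have \<eta>: "\<eta> \<in> D" "\<And>\<xi>. \<xi> \<in> D \<Longrightarrow> cnj (\<Omega> \<xi> \<eta>) = cinner \<zeta> \<xi>"
    by (auto simp: associated_operator_def form_adjoint_def)
  have "cinner \<phi> \<eta> = cinner \<xi> \<zeta>" if "(\<xi>, \<phi>) \<in> associated_operator D \<Omega>" for \<xi> \<phi>
  proof -
    have "\<xi> \<in> D" "\<Omega> \<xi> \<eta> = cinner \<phi> \<eta>"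
      using that \<eta>(1) by (auto simp: associated_operator_def)
    then show ?thesis
      using \<eta>(2)[of \<xi>] cinner_commute[of \<xi> \<zeta>] by (metis complex_cnj_cnj)
  qed
  then show "(\<eta>, \<zeta>) \<in> operator_adjoint (associated_operator D \<Omega>)"
    by (auto simp: operator_adjoint_def)
next
  fix \<eta> \<zeta> assume "(\<eta>, \<zeta>) \<in> operator_adjoint (associated_operator D \<Omega>)"
  then have adj: "cinner \<phi> \<eta> = cinner \<xi> \<zeta>"
    if "\<xi> \<in> D" "\<And>\<eta>. \<eta> \<in> D \<Longrightarrow> \<Omega> \<xi> \<eta> = cinner \<phi> \<eta>" for \<xi> \<phi>
    using that by (auto simp: operator_adjoint_def associated_operator_def)
  have bounded_\<Upsilon>: "bounded_sesquilinear \<Upsilon>"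
    using \<Upsilon> by (simp add: form_perturbations_def)
  then have \<Upsilon>_add: "\<Upsilon> (x + y) z = \<Upsilon> x z + \<Upsilon> y z" "\<Upsilon> x (y + z) = \<Upsilon> x y + \<Upsilon> x z"
    and \<Upsilon>_scale: "\<Upsilon> (c *\<^sub>C x) y = c * \<Upsilon> x y" "\<Upsilon> x (c *\<^sub>C y) = cnj c * \<Upsilon> x y" for x y z c
    by (simp_all add: bounded_sesquilinear_def sesquilinear_on_def)
  obtain b where b: "\<And>\<xi> \<eta>. cmod (\<Upsilon> \<xi> \<eta>) \<le> b * norm \<xi> * norm \<eta>"
    using bounded_\<Upsilon> unfolding bounded_sesquilinear_def by blast
  \<comment> \<open>A priori \<open>\<eta>\<close> may lie outside \<open>D\<close>, but
    \<open>\<Upsilon>\<close> is bounded on the whole space. Were \<open>\<eta>\<close> in the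
    domain sought, the left side would be the perturbed adjoint form at \<open>\<eta>\<close>; so
    \<open>\<eta>'\<close> is the candidate for \<open>\<eta>\<close>.\<close>
  have "\<exists>\<eta>'\<in>D. \<forall>\<xi>\<in>D. cinner \<zeta> \<xi> + form_adjoint \<Upsilon> \<eta> \<xi>
      = form_adjoint \<Omega> \<eta>' \<xi> + form_adjoint \<Upsilon> \<eta>' \<xi>"
  proof (rule form_perturbation_represents[OF subspace q_closed_form_adjoint[OF q_closed]
        form_adjoint_in_form_perturbations[OF subspace q_closed \<Upsilon>]])
    show "cmod (cinner \<zeta> x + form_adjoint \<Upsilon> \<eta> x) \<le> (norm \<zeta> + b * norm \<eta>) * norm x" for x
      using norm_triangle_ineq[of "cinner \<zeta> x" "form_adjoint \<Upsilon> \<eta> x"]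
        cinner_Cauchy_Schwarz[of \<zeta> x] b[of x \<eta>]
      by (simp add: form_adjoint_def algebra_simps)
  qed (simp_all add: form_adjoint_def \<Upsilon>_add \<Upsilon>_scale cinner_add_right cinner_scaleC_right algebra_simps)
  then obtain \<eta>' where \<eta>': "\<eta>' \<in> D"
    and eq: "\<And>\<xi>. \<xi> \<in> D \<Longrightarrow> cinner \<zeta> \<xi> + form_adjoint \<Upsilon> \<eta> \<xi>
      = form_adjoint \<Omega> \<eta>' \<xi> + form_adjoint \<Upsilon> \<eta>' \<xi>"
    by blast
  define d where "d = \<eta> - \<eta>'"
  \<comment> \<open>The perturbed form represents \<open>d\<close>; with the Riesz vector
    \<open>z\<close> of \<open>\<Upsilon> \<xi>\<close>, this puts \<open>\<xi>\<close> into the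
    domain of the associated operator, with image \<open>d - z\<close>.\<close>
  obtain \<xi> where \<xi>: "\<xi> \<in> D" "\<And>\<eta>. \<eta> \<in> D \<Longrightarrow> cinner d \<eta> = \<Omega> \<xi> \<eta> + \<Upsilon> \<xi> \<eta>"
    using form_perturbation_represents[OF subspace q_closed \<Upsilon>, of "cinner d" "norm d"]
      cinner_Cauchy_Schwarz[of d]
    by (auto simp: cinner_add_right cinner_scaleC_right)
  obtain z where z: "\<And>\<eta>. \<Upsilon> \<xi> \<eta> = cinner z \<eta>"
    using Riesz_representation[of "\<Upsilon> \<xi>" "b * norm \<xi>"] b \<Upsilon>_add \<Upsilon>_scale by blast
  have "\<Omega> \<xi> \<theta> = cinner (d - z) \<theta>" if "\<theta> \<in> D" for \<theta>
    using \<xi>(2)[OF that] z by (simp add: cinner_diff_left)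
  then have "cinner (d - z) \<eta> = cinner \<xi> \<zeta>" and \<Omega>_eq: "\<Omega> \<xi> \<eta>' = cinner (d - z) \<eta>'"
    using adj[OF \<xi>(1)] \<eta>' by auto
  \<comment> \<open>This is \<open>eq\<close> at \<open>\<xi>\<close>, conjugated. Its two sides are
    \<open>cinner d \<eta>\<close> and \<open>cinner d \<eta>'\<close> once
    \<open>\<Upsilon> \<xi>\<close> is written through \<open>z\<close>.\<close>
  moreover have "cinner \<xi> \<zeta> + \<Upsilon> \<xi> \<eta> = \<Omega> \<xi> \<eta>' + \<Upsilon> \<xi> \<eta>'"
    using arg_cong[OF eq[OF \<xi>(1)], of cnj] cinner_commute[of \<xi> \<zeta>]
    by (simp add: form_adjoint_def)
  ultimately have "cinner d \<eta> = cinner d \<eta>'"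
    unfolding z cinner_diff_left by (metis add_diff_cancel_left' diff_add_cancel)
  then have "cinner d d = 0"
    using cinner_diff_right[of d \<eta> \<eta>'] by (simp flip: d_def)
  then have "\<eta> = \<eta>'"
    by (simp add: cinner_eq_zero_iff d_def)
  \<comment> \<open>With \<open>\<eta>' = \<eta>\<close> the \<open>\<Upsilon>\<close> terms of
    \<open>eq\<close> cancel.\<close>
  then show "(\<eta>, \<zeta>) \<in> associated_operator D (form_adjoint \<Omega>)"
    using \<eta>' eq by (simp add: associated_operator_def)
qed

theorem theorem4p11:
  fixes D :: "'a::complex_hilbert_space set"
    and \<Omega> :: "'a \<Rightarrow> 'a \<Rightarrow> complex"
    and N :: "'a \<Rightarrow> real"
  assumes "complex_vector.subspace D"
    and "closure D = UNIV"
    and "sesquilinear_on D \<Omega>"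
    and "norm_on D N"
    and "q_closed D N \<Omega>"
  shows "q_closed D N (form_adjoint \<Omega>) \<and>
    (\<forall>\<Upsilon>. \<Upsilon> \<in> form_perturbations D N \<Omega> \<longleftrightarrow>
          form_adjoint \<Upsilon> \<in> form_perturbations D N (form_adjoint \<Omega>)) \<and>
    (solvable D N \<Omega> \<longrightarrow>
       solvable D N (form_adjoint \<Omega>) \<and>
       associated_operator D (form_adjoint \<Omega>) = operator_adjoint (associated_operator D \<Omega>))"
proof -
  have q_closed: "q_closed D N (form_adjoint \<Omega>)"
    by (rule q_closed_form_adjoint[OF assms(5)])
  \<comment> \<open>The converse is the same lemma for the adjoint forms, whose adjoints are the
    original ones.\<close>
  have iff: "\<Upsilon> \<in> form_perturbations D N \<Omega> \<longleftrightarrow>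
      form_adjoint \<Upsilon> \<in> form_perturbations D N (form_adjoint \<Omega>)" for \<Upsilon>
    using form_adjoint_in_form_perturbations[OF assms(1,5), of \<Upsilon>]
      form_adjoint_in_form_perturbations[OF assms(1) q_closed, of "form_adjoint \<Upsilon>"]
    by auto
  have "solvable D N (form_adjoint \<Omega>) \<and>
      associated_operator D (form_adjoint \<Omega>) = operator_adjoint (associated_operator D \<Omega>)"
    if "solvable D N \<Omega>"
  proof -
    obtain \<Upsilon> where "\<Upsilon> \<in> form_perturbations D N \<Omega>"
      using \<open>solvable D N \<Omega>\<close> by (auto simp: solvable_def)
    then show ?thesis
      using associated_operator_form_adjoint[OF assms(1,5)] iff q_closed
      by (auto simp: solvable_def)
  qed
  with q_closed iff show ?thesis by blast
qed

end
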